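(* Let $\beta,\psi_0,M$ be real constants, $\kappa>0$, $p\in\mathbb{R}\setminus\{0,-\tfrac12\}$, and let $I\subset(0,\infty)$ be an open interval on which $f(r):=\frac{1}{2p+1}-2Mr^{-2p-1}>0$. Set $\tilde{\mathcal{C}}\equiv0$, $\mathcal{V}\equiv0$, $\mathcal{A}(\psi)=-\frac{p\beta}{4}\psi^2$, and $$A(r)=\sqrt{f(r)},\qquad C(r)=1,\qquad \psi(r)=\psi_0r^p .$$ Then $E^{(2)}_{tt}=E^{(2)}_{rr}=E^{(2)}_{\vartheta\vartheta}=E^{(2)}_{\psi}=0$ hold on $I$, i.e. the metric ${\rm d}s^2=f\,{\rm d}t^2-f^{-1}{\rm d}r^2-r^2{\rm d}\Omega^2$ with this scalar field solves the complex-tetrad vacuum field equations.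
   Context: Metric ansatz ${\rm d}s^2=A(r)^2{\rm d}t^2-\frac{C(r)^2}{A(r)^2}{\rm d}r^2-r^2{\rm d}\Omega^2$, scalar field $\psi=\psi(r)$. Primes on $A,C,\psi$ are $r$-derivatives; $\mathcal{A}',\tilde{\mathcal{C}}',\tilde{\mathcal{C}}'',\mathcal{V}'$ are $\psi$-derivatives evaluated at $\psi(r)$. The complex-tetrad reduced vacuum field equations of the scalar-torsion theory are: $E^{(2)}_{tt}:\ 0=\mathcal{A}\frac{A^2(-2rACA'-A^2(C-2rC')+C^3)}{r^2C^3}+\tilde{\mathcal{C}}'\frac{A^3(C(A'\psi'+A\psi'')-AC'\psi')}{C^3}-\frac{2A^4\psi'\mathcal{A}'}{rC^2}+\frac{A^4\psi'^2\tilde{\mathcal{C}}''}{C^2}-\frac{\beta A^4\psi'^2}{2C^2}+\kappa^2A^2\mathcal{V}$; $E^{(2)}_{rr}:\ 0=\frac{\mathcal{A}(-2rAA'-A^2+C^2)}{r^2A^2}+\big(\frac{A'}{A}+\frac2r\big)\psi'\tilde{\mathcal{C}}'+\frac{\kappa^2C^2\mathcal{V}}{A^2}+\frac12\beta\psi'^2$; $E^{(2)}_{\vartheta\vartheta}:\ 0=-\mathcal{A}'\frac{A(rA'+A)\psi'}{rC^2}+\tilde{\mathcal{C}}'\frac{A(C(A'\psi'+A\psi'')-AC'\psi')}{C^3}+\frac{\mathcal{A}(-rCA'^2+A(rA'C'-C(rA''+2A'))+A^2C')}{rC^3}+\frac{A^2\psi'^2\tilde{\mathcal{C}}''}{C^2}-\frac{\beta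 A^2\psi'^2}{2C^2}+\kappa^2\mathcal{V}$; $E^{(2)}_{\psi}:\ 0=\frac{(2rAA'+A^2+C^2)\mathcal{A}'}{r^2C^2}+\frac{\beta A(2rCA'\psi'+A(C(r\psi''+2\psi')-rC'\psi'))}{rC^3}+\frac{\tilde{\mathcal{C}}'(r^2CA'^2+rA(C(rA''+6A')-rA'C')+2A^2(C-rC'))}{r^2C^3}+\kappa^2\mathcal{V}'$. *)

theory Defs
  imports "HOL-Analysis.Analysis"
begin

text \<open>Reduced complex-tetrad vacuum field equations. Arguments:
  coupling functions AA (= calligraphic A), Ct (= tilde C), V of psi;
  constants beta, kappa; metric functions A, C and scalar field psi of r; the point r.\<close>

definition E_tt :: "(real \<Rightarrow> real) \<Rightarrow> (real \<Rightarrow> real) \<Rightarrow> (real \<Rightarrow> real) \<Rightarrow> real \<Rightarrow> real \<Rightarrow>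
    (real \<Rightarrow> real) \<Rightarrow> (real \<Rightarrow> real) \<Rightarrow> (real \<Rightarrow> real) \<Rightarrow> real \<Rightarrow> real" where
  "E_tt AA Ct V \<beta> \<kappa> A C \<psi> r =
    (let a = A r; a1 = deriv A r; c = C r; c1 = deriv C r;
         p1 = deriv \<psi> r; p2 = deriv (deriv \<psi>) r; s = \<psi> r in
     AA s * (a^2 * (-2*r*a*c*a1 - a^2*(c - 2*r*c1) + c^3)) / (r^2 * c^3)
     + deriv Ct s * (a^3 * (c*(a1*p1 + a*p2) - a*c1*p1)) / c^3
     - 2 * a^4 * p1 * deriv AA s / (r * c^2)
     + a^4 * p1^2 * deriv (deriv Ct) s / c^2
     - \<beta> * a^4 * p1^2 / (2 * c^2)
     + \<kappa>^2 * a^2 * V s)"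

definition E_rr :: "(real \<Rightarrow> real) \<Rightarrow> (real \<Rightarrow> real) \<Rightarrow> (real \<Rightarrow> real) \<Rightarrow> real \<Rightarrow> real \<Rightarrow>
    (real \<Rightarrow> real) \<Rightarrow> (real \<Rightarrow> real) \<Rightarrow> (real \<Rightarrow> real) \<Rightarrow> real \<Rightarrow> real" where
  "E_rr AA Ct V \<beta> \<kappa> A C \<psi> r =
    (let a = A r; a1 = deriv A r; c = C r;
         p1 = deriv \<psi> r; s = \<psi> r in
     AA s * (-2*r*a*a1 - a^2 + c^2) / (r^2 * a^2)
     + (a1 / a + 2 / r) * p1 * deriv Ct s
     + \<kappa>^2 * c^2 * V s / a^2
     + 1/2 * \<beta> * p1^2)"

definition E_thth :: "(real \<Rightarrow> real) \<Rightarrow> (real \<Rightarrow> real) \<Rightarrow> (real \<Rightarrow> real) \<Rightarrow> real \<Rightarrow> real \<Rightarrow>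
    (real \<Rightarrow> real) \<Rightarrow> (real \<Rightarrow> real) \<Rightarrow> (real \<Rightarrow> real) \<Rightarrow> real \<Rightarrow> real" where
  "E_thth AA Ct V \<beta> \<kappa> A C \<psi> r =
    (let a = A r; a1 = deriv A r; a2 = deriv (deriv A) r; c = C r; c1 = deriv C r;
         p1 = deriv \<psi> r; p2 = deriv (deriv \<psi>) r; s = \<psi> r in
     - deriv AA s * (a * (r*a1 + a) * p1) / (r * c^2)
     + deriv Ct s * (a * (c*(a1*p1 + a*p2) - a*c1*p1)) / c^3
     + AA s * (-r*c*a1^2 + a*(r*a1*c1 - c*(r*a2 + 2*a1)) + a^2*c1) / (r * c^3)
     + a^2 * p1^2 * deriv (deriv Ct) s / c^2
     - \<beta> * a^2 * p1^2 / (2 * c^2)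
     + \<kappa>^2 * V s)"

definition E_psi :: "(real \<Rightarrow> real) \<Rightarrow> (real \<Rightarrow> real) \<Rightarrow> (real \<Rightarrow> real) \<Rightarrow> real \<Rightarrow> real \<Rightarrow>
    (real \<Rightarrow> real) \<Rightarrow> (real \<Rightarrow> real) \<Rightarrow> (real \<Rightarrow> real) \<Rightarrow> real \<Rightarrow> real" where
  "E_psi AA Ct V \<beta> \<kappa> A C \<psi> r =
    (let a = A r; a1 = deriv A r; a2 = deriv (deriv A) r; c = C r; c1 = deriv C r;
         p1 = deriv \<psi> r; p2 = deriv (deriv \<psi>) r; s = \<psi> r in
     (2*r*a*a1 + a^2 + c^2) * deriv AA s / (r^2 * c^2)
     + \<beta> * a * (2*r*c*a1*p1 + a*(c*(r*p2 + 2*p1) - r*c1*p1)) / (r * c^3)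
     + deriv Ct s * (r^2*c*a1^2 + r*a*(c*(r*a2 + 6*a1) - r*a1*c1) + 2*a^2*(c - r*c1))
         / (r^2 * c^3)
     + \<kappa>^2 * deriv V s)"

end

theory Submission
  imports Defs
begin

text \<open>Write \<open>f = A\<^sup>2\<close>. With \<open>C = 1\<close> and vanishing \<open>Ct\<close> and \<open>V\<close>, the coupling
  \<open>AA(\<psi>)\<close> and the kinetic term \<open>\<psi>'\<^sup>2\<close> both scale like \<open>r powr (2p)\<close>, so each field
  equation becomes an algebraic consequence of the linear ODE \<open>r f' + (2p + 1) f = 1\<close>
  and of its derivative \<open>r f'' + (2p + 2) f' = 0\<close>. The metric function of the theorem is
  the general solution \<open>1/(2p + 1) + c r powr (-2p - 1)\<close> of that ODE, with \<open>c = -2M\<close>.\<close>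

lemma deriv2_eqI:
  fixes f :: "real \<Rightarrow> real"
  assumes "open S" "x \<in> S"
    and "\<And>t. t \<in> S \<Longrightarrow> (f has_real_derivative f' t) (at t)"
    and "(f' has_real_derivative f'') (at x)"
  shows "deriv f x = f' x" and "deriv (deriv f) x = f''"
proof -
  have "\<forall>\<^sub>F t in nhds x. deriv f t = f' t"
    using eventually_nhds_in_open[OF assms(1,2)]
    by eventually_elim (use assms(3) DERIV_imp_deriv in blast)
  then show "deriv f x = f' x" and "deriv (deriv f) x = f''"
    using eventually_nhds_x_imp_x deriv_cong_ev[of "deriv f" f' x x] DERIV_imp_deriv[OF assms(4)]
    by auto
qed

lemma deriv2_scaled_powr:
  fixes c q x :: real
  assumes "x > 0"
  shows "deriv (\<lambda>t. c * t powr q) x = c * q * x powr q / x"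
    and "deriv (deriv (\<lambda>t. c * t powr q)) x = c * q * (q - 1) * x powr q / x\<^sup>2"
proof -
  have d: "((\<lambda>t. c * t powr q) has_real_derivative c * q * t powr (q - 1)) (at t)"
    if "t \<in> {0<..}" for t
    using that by (auto intro!: derivative_eq_intros)
  have dd: "((\<lambda>t. c * q * t powr (q - 1)) has_real_derivative
      c * q * (q - 1) * x powr (q - 1 - 1)) (at x)"
    using assms by (auto intro!: derivative_eq_intros)
  have "deriv (\<lambda>t. c * t powr q) x = c * q * x powr (q - 1)"
    and "deriv (deriv (\<lambda>t. c * t powr q)) x = c * q * (q - 1) * x powr (q - 1 - 1)"
    using deriv2_eqI[OF open_greaterThan _ d dd] assms by auto
  with assms
  show "deriv (\<lambda>t. c * t powr q) x = c * q * x powr q / x"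
    and "deriv (deriv (\<lambda>t. c * t powr q)) x = c * q * (q - 1) * x powr q / x\<^sup>2"
    by (simp_all add: powr_diff power2_eq_square)
qed

lemma deriv2_sqrt_comp:
  fixes f f' :: "real \<Rightarrow> real"
  assumes "open S" "x \<in> S"
    and "\<And>t. t \<in> S \<Longrightarrow> (f has_real_derivative f' t) (at t)"
    and "\<And>t. t \<in> S \<Longrightarrow> f t > 0"
    and "(f' has_real_derivative f'') (at x)"
  shows "deriv (\<lambda>t. sqrt (f t)) x = f' x / (2 * sqrt (f x))"
    and "deriv (deriv (\<lambda>t. sqrt (f t))) x = f'' / (2 * sqrt (f x)) - f' x ^ 2 / (4 * sqrt (f x) ^ 3)"
proof -
  have d: "((\<lambda>t. sqrt (f t)) has_real_derivative f' t / (2 * sqrt (f t))) (at t)" if "t \<in> S" for t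
    using assms(3,4)[OF that] by (auto intro!: derivative_eq_intros simp: field_simps)
  have dd: "((\<lambda>t. f' t / (2 * sqrt (f t))) has_real_derivative
      f'' / (2 * sqrt (f x)) - f' x ^ 2 / (4 * sqrt (f x) ^ 3)) (at x)"
    using assms(3,4)[OF assms(2)] assms(5)
    by (auto intro!: derivative_eq_intros simp: field_simps power3_eq_cube power2_eq_square)
  from deriv2_eqI[OF assms(1,2) d dd]
  show "deriv (\<lambda>t. sqrt (f t)) x = f' x / (2 * sqrt (f x))"
    and "deriv (deriv (\<lambda>t. sqrt (f t))) x = f'' / (2 * sqrt (f x)) - f' x ^ 2 / (4 * sqrt (f x) ^ 3)"
    by auto
qed

lemma field_equations_vanish_if_ode:
  fixes f f' f'' :: "real \<Rightarrow> real" and S :: "real set" and p \<beta> \<kappa> \<psi>\<^sub>0 r :: real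
  assumes "open S" "S \<subseteq> {0<..}" "r \<in> S"
    and "\<And>t. t \<in> S \<Longrightarrow> (f has_real_derivative f' t) (at t)"
    and "\<And>t. t \<in> S \<Longrightarrow> f t > 0"
    and "(f' has_real_derivative f'' r) (at r)"
    and "r * f' r + (2*p + 1) * f r = 1" and "r * f'' r + (2*p + 2) * f' r = 0"
  defines "A \<equiv> \<lambda>t. sqrt (f t)" and "C \<equiv> \<lambda>t. 1" and "\<psi> \<equiv> \<lambda>t. \<psi>\<^sub>0 * t powr p"
    and "AA \<equiv> \<lambda>s. - p*\<beta>/4 * s^2" and "Ct \<equiv> \<lambda>s. 0" and "V \<equiv> \<lambda>s. 0"
  shows "E_tt AA Ct V \<beta> \<kappa> A C \<psi> r = 0 \<and> E_rr AA Ct V \<beta> \<kappa> A C \<psi> r = 0 \<and>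
    E_thth AA Ct V \<beta> \<kappa> A C \<psi> r = 0 \<and> E_psi AA Ct V \<beta> \<kappa> A C \<psi> r = 0"
proof -
  have r: "r > 0" using assms(2,3) by auto
  define a where "a = sqrt (f r)"
  define u where "u = r powr p"
  have a: "a > 0" "a\<^sup>2 = f r" using assms(5)[OF assms(3)] by (auto simp: a_def)
  have f': "f' r = (1 - (2*p + 1) * a\<^sup>2) / r" and f'': "f'' r = - (2*p + 2) * f' r / r"
    using assms(7,8) r a by (auto simp: field_simps)
  have AA': "deriv AA s = - p*\<beta>/2 * s" for s
    unfolding AA_def by (rule DERIV_imp_deriv) (auto intro!: derivative_eq_intros)
  have A: "deriv A r = f' r / (2 * a)" "deriv (deriv A) r = f'' r / (2 * a) - f' r ^ 2 / (4 * a ^ 3)"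
    unfolding A_def a_def using deriv2_sqrt_comp[of S r f f' "f'' r"] assms(1,3-6) by auto
  have \<psi>: "deriv \<psi> r = \<psi>\<^sub>0 * p * u / r" "deriv (deriv \<psi>) r = \<psi>\<^sub>0 * p * (p - 1) * u / r\<^sup>2"
    unfolding \<psi>_def u_def using deriv2_scaled_powr[OF r] by auto
  show ?thesis
    unfolding E_tt_def E_rr_def E_thth_def E_psi_def Let_def A \<psi> AA'
    unfolding C_def Ct_def V_def deriv_const
    unfolding A_def AA_def \<psi>_def a_def[symmetric] u_def[symmetric] f'' f'
    using r a(1) by (simp add: field_simps) algebra
qed

lemma metric_function_solves_ode:
  fixes p M r :: real
  assumes "r > 0" "p \<noteq> -1/2"
  defines "f \<equiv> \<lambda>t. 1/(2*p + 1) - 2*M * t powr (-2*p - 1)"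
    and "f' \<equiv> \<lambda>t. 2*M * (2*p + 1) * t powr (-2*p - 2)"
    and "f'' \<equiv> \<lambda>t. - 2*M * (2*p + 1) * (2*p + 2) * t powr (-2*p - 3)"
  shows "(f has_real_derivative f' r) (at r)" and "(f' has_real_derivative f'' r) (at r)"
    and "r * f' r + (2*p + 1) * f r = 1" and "r * f'' r + (2*p + 2) * f' r = 0"
proof -
  have p: "2*p + 1 \<noteq> 0" using assms(2) by linarith
  have shift: "r * r powr (q - 1) = r powr q" for q
    using assms(1) by (simp add: powr_diff)
  have "r * r powr (-2*p - 2) = r powr (-2*p - 1)"
    using shift[of "-2*p - 1"] by (simp add: diff_diff_eq)
  then have rf': "r * f' r = 2*M * (2*p + 1) * r powr (-2*p - 1)"
    unfolding f'_def by (simp add: mult.left_commute)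
  have "r * f'' r = - 2*M * (2*p + 1) * (2*p + 2) * (r * r powr (-2*p - 3))"
    unfolding f''_def by (simp add: algebra_simps)
  also have "r * r powr (-2*p - 3) = r powr (-2*p - 2)"
    using shift[of "-2*p - 2"] by (simp add: diff_diff_eq)
  finally have rf'': "r * f'' r = - (2*p + 2) * f' r"
    unfolding f'_def by (simp add: algebra_simps)
  show "(f has_real_derivative f' r) (at r)" and "(f' has_real_derivative f'' r) (at r)"
    unfolding f_def f'_def f''_def using assms(1)
    by (auto intro!: derivative_eq_intros simp: algebra_simps)
  show "r * f' r + (2*p + 1) * f r = 1"
    using p unfolding rf' f_def by (simp add: field_simps)
  show "r * f'' r + (2*p + 2) * f' r = 0"
    unfolding rf'' by (simp add: algebra_simps)
qed

theorem mainTheorem7: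
  fixes \<beta> \<psi>\<^sub>0 M \<kappa> p :: real and I :: "real set"
  assumes "\<kappa> > 0" and "p \<noteq> 0" and "p \<noteq> -1/2"
    and "open I" and "is_interval I" and "I \<noteq> {}" and "I \<subseteq> {0<..}"
    and "\<forall>r\<in>I. 1/(2*p+1) - 2*M * r powr (-2*p-1) > 0"
  shows "\<forall>r\<in>I.
    (let f = (\<lambda>r. 1/(2*p+1) - 2*M * r powr (-2*p-1));
         A = (\<lambda>r. sqrt (f r)); C = (\<lambda>r. 1::real); \<psi> = (\<lambda>r. \<psi>\<^sub>0 * r powr p);
         AA = (\<lambda>s. - p*\<beta>/4 * s^2); Ct = (\<lambda>s. 0::real); V = (\<lambda>s. 0::real) in
     E_tt AA Ct V \<beta> \<kappa> A C \<psi> r = 0 \<and> E_rr AA Ct V \<beta> \<kappa> A C \<psi> r = 0 \<and>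
     E_thth AA Ct V \<beta> \<kappa> A C \<psi> r = 0 \<and> E_psi AA Ct V \<beta> \<kappa> A C \<psi> r = 0)"
proof -
  have "t > 0" if "t \<in> I" for t
    using that assms(7) by auto
  note ode = metric_function_solves_ode[OF this assms(3), of _ M]
  show ?thesis
    unfolding Let_def
    by (intro ballI field_equations_vanish_if_ode[where S = I
          and f = "\<lambda>t. 1/(2*p + 1) - 2*M * t powr (-2*p - 1)"
          and f' = "\<lambda>t. 2*M * (2*p + 1) * t powr (-2*p - 2)"
          and f'' = "\<lambda>t. - 2*M * (2*p + 1) * (2*p + 2) * t powr (-2*p - 3)"])
       (use assms(4,7,8) ode in auto)
qed

end
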